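(* Let $n\ge 2$, let $A$ be a real symmetric positive definite $n\times n$ matrix, and let $u\in\mathbb{R}^n$, $u\neq 0$. Let $A=QDQ^T$ be the orthogonal spectral decomposition of $A$ ($Q$ orthogonal, $D$ diagonal). Let $U=uu^T$ and define the rank one update $A(\gamma)=A+\gamma U$ for $\gamma\in\mathbb{R}$. Set $$w = D^{-1/2}Q^Tu,\qquad \gamma^* = \frac{\operatorname{trace}(A)\,\|w\|^2-n\|u\|^2}{(n-1)\|u\|^2\|w\|^2}.$$ Then $\gamma^*\in\left]-\|w\|^{-2},+\infty\right[$ and $\gamma^*$ provides the $\omega$-optimal conditioning, i.e. $$\gamma^* = \operatorname*{argmin}_{\gamma\in\mathbb{R},\ A(\gamma)\succ 0} \ \omega(A(\gamma)).$$
   Context: For a real symmetric positive definite $n\times n$ matrix $M$, $\omega(M)=\dfrac{\operatorname{trace}(M)/n}{\det(M)^{1/n}}$. $\|\cdot\|$ is the Euclidean norm, and $M\succ0$ means $M$ is positive definite. *)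

theory Defs
  imports "HOL-Analysis.Analysis"
begin

definition pos_def_matrix :: "real^'n^'n \<Rightarrow> bool" where
  "pos_def_matrix M \<longleftrightarrow> transpose M = M \<and> (\<forall>x. x \<noteq> 0 \<longrightarrow> 0 < x \<bullet> (M *v x))"

definition diagonal_matrix :: "real^'n^'n \<Rightarrow> bool" where
  "diagonal_matrix D \<longleftrightarrow> (\<forall>i j. i \<noteq> j \<longrightarrow> D $ i $ j = 0)"

(* The matrix power with exponent -1/2, for diagonal matrices with positive diagonal entries. *)
definition diag_inv_sqrt :: "real^'n^'n \<Rightarrow> real^'n^'n" where
  "diag_inv_sqrt D = (\<chi> i j. if i = j then 1 / sqrt (D $ i $ i) else 0)"

(* Meaningful for positive definite M only, where the determinant is positive. *)
definition omega_cond :: "real^'n^'n \<Rightarrow> real" where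
  "omega_cond M = (trace M / real CARD('n)) / root CARD('n) (det M)"

definition rank_one_update :: "real^'n^'n \<Rightarrow> real^'n \<Rightarrow> real \<Rightarrow> real^'n^'n" where
  "rank_one_update A u \<gamma> =
     A + \<gamma> *\<^sub>R ((columnvector u :: real^1^'n) ** (rowvector u :: real^'n^1))"

end

theory Submission
  imports Defs
begin

text \<open>Write \<open>n\<close> for the dimension. With \<open>S = D\<^sup>1\<^sup>/\<^sup>2 Q\<^sup>T\<close> one has \<open>A = S\<^sup>T S\<close> and \<open>u = S\<^sup>T w\<close>, so
  every update is a congruence \<open>A(\<gamma>) = S\<^sup>T (I + \<gamma> w w\<^sup>T) S\<close>, with the same \<open>S\<close> for all \<open>\<gamma>\<close>
  (\<open>spectral_factorization\<close>, \<open>rank_one_update_congruence\<close>). Put \<open>t = 1 + \<gamma> (norm w)\<^sup>2\<close>. Then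
  \<open>A(\<gamma>)\<close> is positive definite exactly when \<open>t > 0\<close>, and \<open>det A(\<gamma>) = t * det A\<close>
  (\<open>pos_def_rank_one_update_identity\<close>, \<open>det_rank_one_update_identity\<close>).

  The trace is affine in \<open>\<gamma>\<close>, hence in \<open>t\<close>. If \<open>t\<^sub>0\<close> is the value of \<open>t\<close> at the claimed
  minimizer, the trace is a positive multiple of \<open>(n - 1) t\<^sub>0 + t\<close>. So up to a positive factor
  \<open>\<omega>(A(\<gamma>))\<close> is \<open>((n - 1) t\<^sub>0 + t) / root n t\<close>, and the weighted arithmetic-geometric mean
  inequality says that this has its only minimum over \<open>t > 0\<close> at \<open>t = t\<^sub>0\<close>
  (\<open>strict_weighted_AM_GM\<close>).

  What remains is that \<open>t\<^sub>0 > 0\<close>, which is also the claimed lower bound for the minimizer. It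
  amounts to \<open>(norm u)\<^sup>2 < trace A * (norm w)\<^sup>2\<close>; in the eigenbasis of \<open>A\<close> this says that a
  sum of squares weighted by the eigenvalues is smaller than the unweighted sum times the sum
  of all eigenvalues (\<open>weighted_norm_less_sum\<close>). Here \<open>n \<ge> 2\<close> is essential.\<close>

section \<open>Congruence and rank one updates\<close>

text \<open>Only one direction needs an argument: \<open>M\<close> is itself the congruence of
  \<open>transpose S ** M ** S\<close> by the inverse of \<open>S\<close>.\<close>

lemma pos_def_matrix_congruence:
  fixes M S :: "real^'n^'n"
  assumes "invertible S"
  shows "pos_def_matrix (transpose S ** M ** S) \<longleftrightarrow> pos_def_matrix M"
proof -
  obtain R where RS: "R ** S = mat 1" and SR: "S ** R = mat 1"
    using assms unfolding invertible_def by blast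
  have quad: "x \<bullet> ((transpose S ** N ** S) *v x) = (S *v x) \<bullet> (N *v (S *v x))"
    for S N :: "real^'n^'n" and x
    by (simp add: matrix_vector_mul_assoc[symmetric] dot_lmul_matrix[symmetric])
       (metis dot_lmul_matrix inner_commute)
  have dir: "pos_def_matrix (transpose S ** N ** S)"
    if N: "pos_def_matrix N" and RS: "R ** S = mat 1" for N R S :: "real^'n^'n"
    unfolding pos_def_matrix_def
  proof (intro conjI allI impI)
    show "transpose (transpose S ** N ** S) = transpose S ** N ** S"
      using N by (simp add: pos_def_matrix_def matrix_transpose_mul matrix_mul_assoc)
  next
    fix x :: "real^'n" assume "x \<noteq> 0"
    then have "S *v x \<noteq> 0"
      by (metis RS matrix_vector_mul_assoc matrix_vector_mul_lid matrix_vector_mult_0_right)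
    then show "0 < x \<bullet> ((transpose S ** N ** S) *v x)"
      using N by (simp add: quad pos_def_matrix_def)
  qed
  have "transpose R ** (transpose S ** M ** S) ** R = transpose (S ** R) ** M ** (S ** R)"
    by (simp add: matrix_transpose_mul matrix_mul_assoc)
  also have "\<dots> = M"
    by (simp add: SR)
  finally show ?thesis
    using dir RS SR by metis
qed

lemma rank_one_update_component:
  "rank_one_update A u \<gamma> $ i $ j = A $ i $ j + \<gamma> * (u $ i * u $ j)"
  by (simp add: rank_one_update_def matrix_matrix_mult_def columnvector_def rowvector_def)

lemma trace_rank_one_update: "trace (rank_one_update A u \<gamma>) = trace A + \<gamma> * (norm u)\<^sup>2"
  by (simp add: trace_def rank_one_update_component sum.distrib sum_distrib_left
      power2_norm_eq_inner inner_vec_def)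

lemma rank_one_update_quadratic_form:
  "x \<bullet> (rank_one_update A u \<gamma> *v x) = x \<bullet> (A *v x) + \<gamma> * (u \<bullet> x)\<^sup>2"
proof -
  have "rank_one_update A u \<gamma> *v x = A *v x + (\<gamma> * (u \<bullet> x)) *\<^sub>R u"
    by (simp add: vec_eq_iff matrix_vector_mult_def rank_one_update_component inner_vec_def
        algebra_simps sum.distrib sum_distrib_left)
  then show ?thesis
    by (simp add: inner_add_right inner_commute power2_eq_square)
qed

lemma rank_one_update_congruence:
  fixes M S :: "real^'n^'n"
  shows "rank_one_update (transpose S ** M ** S) (transpose S *v w) \<gamma>
    = transpose S ** rank_one_update M w \<gamma> ** S"
proof -
  have col: "columnvector (transpose S *v w) = transpose S ** (columnvector w :: real^1^'n)"
    by (rule dot_rowvector_columnvector)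
  have "(rowvector (transpose S *v w) :: real^'n^1)
      = transpose (columnvector (transpose S *v w))"
    by (simp only: transpose_columnvector)
  also have "\<dots> = (rowvector w :: real^'n^1) ** S"
    unfolding col by (simp only: matrix_transpose_mul transpose_columnvector transpose_transpose)
  finally have row: "(rowvector (transpose S *v w) :: real^'n^1) = (rowvector w :: real^'n^1) ** S" .
  have add_mult: "(B + C) ** S = B ** S + C ** S" for B C :: "real^'n^'n"
    by (simp add: matrix_matrix_mult_def vec_eq_iff distrib_right sum.distrib)
  show ?thesis
    unfolding rank_one_update_def col row
    by (simp only: matrix_add_ldistrib add_mult matrix_scalar_ac
        scalar_matrix_assoc[symmetric] matrix_mul_assoc)
qed

text \<open>An orthogonal \<open>R\<close> carrying a coordinate axis to the direction of \<open>w\<close> turns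
  \<open>mat 1 + \<gamma> w w\<^sup>T\<close> into a diagonal matrix in which only one entry differs from 1.\<close>

lemma det_rank_one_update_identity:
  fixes w :: "real^'n"
  shows "det (rank_one_update (mat 1) w \<gamma>) = 1 + \<gamma> * (norm w)\<^sup>2"
proof (cases "w = 0")
  case True
  have "rank_one_update (mat 1) (0 :: real^'n) \<gamma> = mat 1"
    by (simp add: vec_eq_iff rank_one_update_component)
  with True show ?thesis by simp
next
  case False
  fix k :: 'n
  obtain R :: "real^'n^'n" where R: "orthogonal_matrix R" "R *v axis k 1 = w /\<^sub>R norm w"
    using orthogonal_matrix_exists_basis[of "w /\<^sub>R norm w" k] False by auto
  define e :: "real^'n" where "e = norm w *\<^sub>R axis k 1"
  have w: "w = transpose (transpose R) *v e"
    using False by (simp only: e_def matrix_vector_mult_scaleR R transpose_transpose) simp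
  have RR: "R ** transpose R = mat 1"
    using R(1) by (simp add: orthogonal_matrix_def)
  then have "mat 1 = transpose (transpose R) ** mat 1 ** transpose R"
    by simp
  then have "rank_one_update (mat 1) w \<gamma>
      = transpose (transpose R) ** rank_one_update (mat 1) e \<gamma> ** transpose R"
    by (metis w rank_one_update_congruence)
  then have "det (rank_one_update (mat 1) w \<gamma>)
      = det R * det (transpose R) * det (rank_one_update (mat 1) e \<gamma>)"
    by (simp add: det_mul)
  also have "det R * det (transpose R) = 1"
    using RR by (metis det_I det_mul)
  also have "det (rank_one_update (mat 1) e \<gamma>)
      = (\<Prod>i\<in>UNIV. rank_one_update (mat 1) e \<gamma> $ i $ i)"
    by (rule det_diagonal) (auto simp: rank_one_update_component e_def axis_def mat_def)
  also have "\<dots> = (\<Prod>i\<in>UNIV. if i = k then 1 + \<gamma> * (norm w)\<^sup>2 else 1)"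
    by (rule prod.cong)
       (simp_all add: rank_one_update_component e_def axis_def mat_def power2_eq_square)
  also have "\<dots> = 1 + \<gamma> * (norm w)\<^sup>2"
    by simp
  finally show ?thesis by simp
qed

text \<open>The quadratic form is \<open>(norm x)\<^sup>2 + \<gamma> (w \<bullet> x)\<^sup>2\<close>. Testing it at \<open>x = w\<close> shows that the
  condition is necessary; for negative \<open>\<gamma>\<close> the Cauchy-Schwarz inequality says that the direction
  of \<open>w\<close> is the worst one, so the condition is also sufficient.\<close>

lemma pos_def_rank_one_update_identity:
  fixes w :: "real^'n"
  shows "pos_def_matrix (rank_one_update (mat 1) w \<gamma>) \<longleftrightarrow> 0 < 1 + \<gamma> * (norm w)\<^sup>2"
proof
  assume pd: "pos_def_matrix (rank_one_update (mat 1) w \<gamma>)"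
  show "0 < 1 + \<gamma> * (norm w)\<^sup>2"
  proof (cases "w = 0")
    case False
    then have "0 < w \<bullet> (rank_one_update (mat 1) w \<gamma> *v w)"
      using pd by (simp add: pos_def_matrix_def)
    also have "\<dots> = (norm w)\<^sup>2 * (1 + \<gamma> * (norm w)\<^sup>2)"
      by (simp add: rank_one_update_quadratic_form dot_square_norm power2_eq_square algebra_simps)
    finally show ?thesis
      using False by (simp add: zero_less_mult_iff)
  qed simp
next
  assume pos: "0 < 1 + \<gamma> * (norm w)\<^sup>2"
  show "pos_def_matrix (rank_one_update (mat 1) w \<gamma>)"
    unfolding pos_def_matrix_def
  proof (intro conjI allI impI)
    show "transpose (rank_one_update (mat 1) w \<gamma>) = rank_one_update (mat 1) w \<gamma>"
      by (simp add: vec_eq_iff transpose_def rank_one_update_component mat_def)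
  next
    fix x :: "real^'n" assume x: "x \<noteq> 0"
    have cs: "(w \<bullet> x)\<^sup>2 \<le> (norm w)\<^sup>2 * (norm x)\<^sup>2"
      using Cauchy_Schwarz_ineq[of w x] by (simp add: dot_square_norm)
    have "0 < (norm x)\<^sup>2 + \<gamma> * (w \<bullet> x)\<^sup>2"
    proof (cases "\<gamma> \<ge> 0")
      case True
      with x show ?thesis by (simp add: add_pos_nonneg)
    next
      case False
      have "0 < (norm x)\<^sup>2 * (1 + \<gamma> * (norm w)\<^sup>2)"
        using pos x by simp
      also have "\<dots> = (norm x)\<^sup>2 + \<gamma> * ((norm w)\<^sup>2 * (norm x)\<^sup>2)"
        by (simp add: algebra_simps)
      also have "\<dots> \<le> (norm x)\<^sup>2 + \<gamma> * (w \<bullet> x)\<^sup>2"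
        using False cs by (simp add: mult_left_mono_neg)
      finally show ?thesis .
    qed
    then show "0 < x \<bullet> (rank_one_update (mat 1) w \<gamma> *v x)"
      by (simp add: rank_one_update_quadratic_form dot_square_norm)
  qed
qed

section \<open>The reduced one-variable problem\<close>

text \<open>Multiplying the inequality for \<open>m\<close> by \<open>s\<close> gives the one for \<open>m + 1\<close> with the
  surplus \<open>m (s - 1)\<^sup>2\<close>.\<close>

lemma strict_Bernoulli_inequality:
  fixes s :: real
  assumes "0 < s" "s \<noteq> 1" "2 \<le> n"
  shows "real n * s < s ^ n + (real n - 1)"
  using assms(3)
proof (induction n rule: dec_induct)
  case base
  have "0 < (s - 1)\<^sup>2" using assms(2) by simp
  then show ?case by (simp add: power2_eq_square algebra_simps)
next
  case (step m)
  have "0 < real m * (s - 1)\<^sup>2" using assms(2) step(1) by simp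
  moreover have "s * (real m * s) < s * (s ^ m + (real m - 1))"
    using step.IH assms(1) by simp
  ultimately show ?case by (simp add: power2_eq_square algebra_simps)
qed

text \<open>The weighted arithmetic-geometric mean inequality
  \<open>((n - 1) p + t) / n \<ge> p powr ((n - 1) / n) * t powr (1 / n)\<close>, with equality only for
  \<open>t = p\<close>, is divided here by \<open>root n t\<close>, so that both sides are values of one function at
  \<open>p\<close> and at \<open>t\<close>. In the variable \<open>s = root n (t / p)\<close> it is Bernoulli's inequality.\<close>

lemma strict_weighted_AM_GM:
  fixes p t :: real
  assumes "2 \<le> n" "0 < p" "0 < t" "t \<noteq> p"
  shows "((real n - 1) * p + p) / root n p < ((real n - 1) * p + t) / root n t"
proof -
  define s where "s = root n (t / p)"
  have n: "0 < n" using assms(1) by simp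
  have s: "0 < s" "s ^ n = t / p"
    using assms n by (simp_all add: s_def)
  then have "s \<noteq> 1" using assms by auto
  have "real n * s < t / p + (real n - 1)"
    using strict_Bernoulli_inequality[OF s(1) \<open>s \<noteq> 1\<close> assms(1)] s(2) by simp
  then have "p * (real n * s) < p * (t / p + (real n - 1))"
    using assms(2) by (simp only: mult_less_cancel_left_pos)
  also have "p * (t / p + (real n - 1)) = (real n - 1) * p + t"
    using assms(2) by (simp add: field_simps)
  finally have "real n * p * s < (real n - 1) * p + t"
    by (simp add: mult_ac)
  moreover have "root n t = s * root n p" "0 < root n p"
    using assms n by (simp_all add: s_def real_root_divide)
  ultimately show ?thesis
    using s(1) by (simp add: field_simps)
qed

lemma is_arg_min_set_eq_singleton:
  fixes f :: "'a \<Rightarrow> 'b::order"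
  assumes "P a" "\<And>x. P x \<Longrightarrow> x \<noteq> a \<Longrightarrow> f a < f x"
  shows "{x. is_arg_min f P x} = {a}"
proof (intro equalityI subsetI)
  fix x assume "x \<in> {x. is_arg_min f P x}"
  then show "x \<in> {a}"
    using assms unfolding is_arg_min_def by blast
next
  fix x assume "x \<in> {a}"
  moreover have "\<not> f y < f a" if "P y" for y
    using assms(2)[OF that] less_asym by (cases "y = a") auto
  ultimately show "x \<in> {x. is_arg_min f P x}"
    using assms(1) by (auto simp: is_arg_min_def)
qed

section \<open>The optimal update\<close>

lemma orthogonal_matrix_norm:
  fixes Q :: "real^'n^'n"
  assumes "orthogonal_matrix Q"
  shows "norm (Q *v x) = norm x"
proof (rule orthogonal_transformation_norm)
  show "orthogonal_transformation ((*v) Q)"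
    using assms by (simp add: orthogonal_transformation_matrix)
qed

lemma pos_def_diagonal_pos:
  fixes D :: "real^'n^'n"
  assumes "pos_def_matrix D"
  shows "0 < D $ i $ i"
proof -
  have "0 < axis i 1 \<bullet> (D *v axis i 1)"
    using assms by (simp add: pos_def_matrix_def axis_eq_0_iff)
  then show ?thesis
    by (simp add: inner_axis' matrix_vector_mult_basis column_def)
qed

text \<open>Each of at least two positive weights is smaller than the sum of all of them. This is where
  the dimension matters: in dimension one both sides agree.\<close>

lemma weighted_norm_less_sum:
  fixes w :: "real^'n" and d :: "'n \<Rightarrow> real"
  assumes "2 \<le> CARD('n)" "\<And>i. 0 < d i" "w \<noteq> 0"
  shows "(\<Sum>i\<in>UNIV. d i * (w $ i)\<^sup>2) < (\<Sum>i\<in>UNIV. d i) * (norm w)\<^sup>2"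
proof -
  have less: "d i < (\<Sum>j\<in>UNIV. d j)" for i
  proof -
    have "UNIV - {i} \<noteq> {}"
      using assms(1) by (metis card.empty card_Diff_singleton finite UNIV_I
          diff_is_0_eq not_less_eq_eq numeral_2_eq_2 One_nat_def)
    then have "0 < (\<Sum>j\<in>UNIV - {i}. d j)"
      using assms(2) by (intro sum_pos) auto
    then show ?thesis
      by (simp add: sum.remove[of UNIV i])
  qed
  obtain k where k: "w $ k \<noteq> 0" using assms(3) by (auto simp: vec_eq_iff)
  have "(\<Sum>i\<in>UNIV. d i * (w $ i)\<^sup>2) < (\<Sum>i\<in>UNIV. (\<Sum>j\<in>UNIV. d j) * (w $ i)\<^sup>2)"
  proof (rule sum_strict_mono_ex1)
    show "\<forall>i\<in>UNIV. d i * (w $ i)\<^sup>2 \<le> (\<Sum>j\<in>UNIV. d j) * (w $ i)\<^sup>2"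
      using less by (simp add: mult_right_mono less_imp_le)
    show "\<exists>i\<in>UNIV. d i * (w $ i)\<^sup>2 < (\<Sum>j\<in>UNIV. d j) * (w $ i)\<^sup>2"
      using less k by (intro bexI[of _ k]) auto
  qed simp
  also have "\<dots> = (\<Sum>i\<in>UNIV. d i) * (norm w)\<^sup>2"
    by (simp add: sum_distrib_left power2_norm_eq_inner inner_vec_def power2_eq_square[of "w $ _"])
  finally show ?thesis .
qed

text \<open>The factor is \<open>S = D\<^sup>1\<^sup>/\<^sup>2 Q\<^sup>T\<close>. The middle factor \<open>mat 1\<close> displays \<open>A\<close> as a congruence
  of the identity, the form to which \<open>rank_one_update_congruence\<close> applies. The last inequality
  is independent of \<open>S\<close>, but its proof needs the eigenvalues, since \<open>trace A\<close> is their sum and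
  \<open>norm u = norm (D\<^sup>1\<^sup>/\<^sup>2 w)\<close>.\<close>

lemma spectral_factorization:
  fixes A Q D :: "real^'n^'n" and u w :: "real^'n"
  assumes "CARD('n) \<ge> 2" "pos_def_matrix A" "u \<noteq> 0"
    and Q: "orthogonal_matrix Q" and diag: "diagonal_matrix D"
    and A: "A = Q ** D ** transpose Q"
    and w: "w = diag_inv_sqrt D *v (transpose Q *v u)"
  obtains S where "invertible S" "A = transpose S ** mat 1 ** S" "u = transpose S *v w"
    "w \<noteq> 0" "(norm u)\<^sup>2 < trace A * (norm w)\<^sup>2"
proof
  have QQ: "Q ** transpose Q = mat 1" "transpose Q ** Q = mat 1"
    using Q by (simp_all add: orthogonal_matrix_def)
  then have "invertible (transpose Q)" unfolding invertible_def by blast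
  then have "pos_def_matrix D"
    using assms(2) pos_def_matrix_congruence[of "transpose Q" D] by (simp add: A)
  then have D_pos: "0 < D $ i $ i" for i by (rule pos_def_diagonal_pos)
  define E :: "real^'n^'n" where "E = (\<chi> i j. if i = j then sqrt (D $ i $ i) else 0)"
  have tE: "transpose E = E"
    by (simp add: E_def transpose_def vec_eq_iff)
  have diag_mult: "(\<chi> i j. if i = j then a i else 0) ** (\<chi> i j. if i = j then b i else 0)
      = (\<chi> i j. if i = j then a i * b i else 0)" for a b :: "'n \<Rightarrow> real"
    by (simp add: matrix_matrix_mult_def vec_eq_iff mult_delta_left)
  have EE: "E ** E = D"
    unfolding E_def diag_mult
    using diag D_pos by (simp add: vec_eq_iff diagonal_matrix_def less_imp_le)
  have Einv: "E ** diag_inv_sqrt D = mat 1" "diag_inv_sqrt D ** E = mat 1"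
    unfolding E_def diag_inv_sqrt_def diag_mult
    using D_pos by (simp_all add: vec_eq_iff mat_def less_imp_neq[symmetric])
  let ?S = "E ** transpose Q"
  show "invertible ?S"
    by (rule invertible_mult) (use Einv QQ in \<open>auto simp: invertible_def\<close>)
  show "A = transpose ?S ** mat 1 ** ?S"
    by (simp add: matrix_transpose_mul tE A EE[symmetric] matrix_mul_assoc)
  have Ew: "E *v w = transpose Q *v u"
    by (simp only: w matrix_vector_mul_assoc Einv matrix_mul_assoc matrix_mul_lid)
  have "transpose ?S *v w = Q *v (E *v w)"
    by (simp only: matrix_transpose_mul tE transpose_transpose matrix_vector_mul_assoc)
  also have "\<dots> = u"
    unfolding Ew by (simp only: matrix_vector_mul_assoc QQ matrix_vector_mul_lid)
  finally show u: "u = transpose ?S *v w" ..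
  then show "w \<noteq> 0" using assms(3) by (metis matrix_vector_mult_0_right)
  have "trace A = trace (transpose Q ** Q ** D)"
    unfolding A by (metis trace_mul_sym matrix_mul_assoc)
  then have trA: "trace A = (\<Sum>i\<in>UNIV. D $ i $ i)"
    by (simp only: QQ matrix_mul_lid trace_def)
  have "norm u = norm (E *v w)"
    unfolding Ew using Q by (simp only: orthogonal_matrix_norm orthogonal_matrix_transpose)
  moreover have "(E *v w) $ i = sqrt (D $ i $ i) * w $ i" for i
    by (simp add: E_def matrix_vector_mult_def mult_delta_left)
  ultimately have "(norm u)\<^sup>2 = (\<Sum>i\<in>UNIV. D $ i $ i * (w $ i)\<^sup>2)"
    using D_pos by (simp only: power2_norm_eq_inner inner_vec_def)
      (simp add: power_mult_distrib less_imp_le flip: power2_eq_square)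
  then show "(norm u)\<^sup>2 < trace A * (norm w)\<^sup>2"
    using weighted_norm_less_sum[OF assms(1) D_pos \<open>w \<noteq> 0\<close>] trA by simp
qed

theorem theorem3p2:
  fixes A Q D :: "real^'n^'n" and u w :: "real^'n" and \<gamma>\<^sub>0 :: real
  assumes "CARD('n) \<ge> 2"
    and "pos_def_matrix A"
    and "u \<noteq> 0"
    and "orthogonal_matrix Q" and "diagonal_matrix D" and "A = Q ** D ** transpose Q"
    and "w = diag_inv_sqrt D *v (transpose Q *v u)"
    and "\<gamma>\<^sub>0 = (trace A * (norm w)\<^sup>2 - real CARD('n) * (norm u)\<^sup>2)
               / ((real CARD('n) - 1) * (norm u)\<^sup>2 * (norm w)\<^sup>2)"
  shows "\<gamma>\<^sub>0 \<in> {- (1 / (norm w)\<^sup>2)<..} \<and>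
    {\<gamma>. is_arg_min (\<lambda>\<gamma>. omega_cond (rank_one_update A u \<gamma>))
          (\<lambda>\<gamma>. pos_def_matrix (rank_one_update A u \<gamma>)) \<gamma>} = {\<gamma>\<^sub>0}"
proof -
  obtain S where S: "invertible S" "A = transpose S ** mat 1 ** S" "u = transpose S *v w"
    and w: "w \<noteq> 0" and less: "(norm u)\<^sup>2 < trace A * (norm w)\<^sup>2"
    using spectral_factorization[OF assms(1-7)] by metis
  define n where "n = CARD('n)"
  define t where "t \<gamma> = 1 + \<gamma> * (norm w)\<^sup>2" for \<gamma>
  define c where "c = (norm u)\<^sup>2 / (norm w)\<^sup>2 / (real n * root n (det A))"
  have n: "2 \<le> n" using assms(1) by (simp add: n_def)
  have pos: "0 < (norm w)\<^sup>2" "0 < (norm u)\<^sup>2" "0 < real n - 1"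
    using w assms(3) n by auto
  have upd: "rank_one_update A u \<gamma> = transpose S ** rank_one_update (mat 1) w \<gamma> ** S" for \<gamma>
    unfolding S(2,3) by (rule rank_one_update_congruence)
  have pd: "pos_def_matrix (rank_one_update A u \<gamma>) \<longleftrightarrow> 0 < t \<gamma>" for \<gamma>
    unfolding upd pos_def_matrix_congruence[OF S(1)] pos_def_rank_one_update_identity t_def ..
  have det_A: "det A = (det S)\<^sup>2"
    by (simp add: S(2) det_mul power2_eq_square)
  have det: "det (rank_one_update A u \<gamma>) = det A * t \<gamma>" for \<gamma>
    by (simp add: upd det_mul det_rank_one_update_identity det_A t_def power2_eq_square)
  have "0 < det A"
    using S(1) by (simp add: det_A invertible_det_nz)
  then have c: "0 < c"
    using n pos by (simp add: c_def)

  \<comment> \<open>The next identity is what singles out \<open>\<gamma>\<^sub>0\<close>: it turns the trace into a multiple of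
    \<open>(n - 1) t\<^sub>0 + t\<close>, the shape in which the mean inequality has its equality case at \<open>t\<^sub>0\<close>.\<close>
  have t0: "(real n - 1) * t \<gamma>\<^sub>0 = trace A * (norm w)\<^sup>2 / (norm u)\<^sup>2 - 1"
    using pos by (simp add: t_def assms(8) n_def[symmetric] field_simps)
  have "0 < (real n - 1) * t \<gamma>\<^sub>0"
    unfolding t0 using less pos by simp
  then have t0_pos: "0 < t \<gamma>\<^sub>0"
    using pos(3) by (simp add: zero_less_mult_iff)

  have tr: "trace (rank_one_update A u \<gamma>)
      = (norm u)\<^sup>2 / (norm w)\<^sup>2 * ((real n - 1) * t \<gamma>\<^sub>0 + t \<gamma>)" for \<gamma>
    unfolding trace_rank_one_update t0 using pos by (simp add: t_def field_simps)
  have omega: "omega_cond (rank_one_update A u \<gamma>)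
      = c * (((real n - 1) * t \<gamma>\<^sub>0 + t \<gamma>) / root n (t \<gamma>))" for \<gamma>
    unfolding omega_cond_def tr det n_def[symmetric] c_def by (simp add: real_root_mult)
  have "omega_cond (rank_one_update A u \<gamma>\<^sub>0) < omega_cond (rank_one_update A u \<gamma>)"
    if "0 < t \<gamma>" "\<gamma> \<noteq> \<gamma>\<^sub>0" for \<gamma>
  proof -
    have "t \<gamma> \<noteq> t \<gamma>\<^sub>0" using that(2) w by (simp add: t_def)
    then show ?thesis
      unfolding omega
      by (intro mult_strict_left_mono strict_weighted_AM_GM n t0_pos that(1) c)
  qed
  then have "{\<gamma>. is_arg_min (\<lambda>\<gamma>. omega_cond (rank_one_update A u \<gamma>))
      (\<lambda>\<gamma>. pos_def_matrix (rank_one_update A u \<gamma>)) \<gamma>} = {\<gamma>\<^sub>0}"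
    using t0_pos by (intro is_arg_min_set_eq_singleton) (simp_all only: pd)
  moreover have "- (1 / (norm w)\<^sup>2) < \<gamma>\<^sub>0"
    using t0_pos pos(1) by (simp add: t_def field_simps)
  ultimately show ?thesis by simp
qed

end
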